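(* Let $X$ be a real Banach space with dual $X^*$ and let $A\colon X\rightrightarrows X^*$ be maximally monotone. Then $$\overline{\operatorname{conv}[\operatorname{dom} A]}=\overline{P_X[\operatorname{dom} F_A]}.$$
   Context: $X$ is a real Banach space, $X^*$ its continuous dual, $\langle\cdot,\cdot\rangle$ the duality pairing. A set-valued operator $A\colon X\rightrightarrows X^*$ assigns to each $x\in X$ a (possibly empty) subset $Ax\subseteq X^*$; $\operatorname{gra}A=\{(x,x^* )\in X\times X^*: x^*\in Ax\}$ and $\operatorname{dom}A=\{x\in X: Ax\ne\varnothing\}$. $A$ is monotone if $\langle x-y,x^*-y^*\rangle\ge 0$ for all $(x,x^* ),(y,y^* )\in\operatorname{gra}A$, and maximally monotone if it is monotone and no monotone operator has a graph properly containing $\operatorname{gra}A$. For $\operatorname{gra}A\neq\varnothing$, the Fitzpatrick function $F_A\colon X\times X^*\to\,]-\infty,+\infty]$ is $F_A(x,x^* )=\sup_{(a,a^* )\in\operatorname{gra}A}\big(\langle x,a^*\rangle+\langle a,x^*\rangle-\langle a,a^*\rangle\big)$, with $\operatorname{dom}F_A=\{(x,x^* ): F_A(x,x^* )\in\mathbb R\}$. $P_X\colon X\times X^*\to X$, $(x,x^* )\mapsto x$. $\overline{C}$ is the norm closure and $\operatorname{conv}C$ the convex hull of $C$. *)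

theory Defs
  imports "HOL-Analysis.Analysis"
begin

text \<open>The continuous dual of \<open>'a\<close> is the type of bounded linear functionals on \<open>'a\<close>;
  the duality pairing of \<open>x\<close> and \<open>x'\<close> is \<open>blinfun_apply x' x\<close>.\<close>

type_synonym 'a dual = "'a \<Rightarrow>\<^sub>L real"

type_synonym 'a set_operator = "'a \<Rightarrow> 'a dual set"

definition gra :: "('a::real_normed_vector) set_operator \<Rightarrow> ('a \<times> 'a dual) set" where
  "gra A = {(x, x'). x' \<in> A x}"

definition dom_op :: "('a::real_normed_vector) set_operator \<Rightarrow> 'a set" where
  "dom_op A = {x. A x \<noteq> {}}"

definition monotone_op :: "('a::real_normed_vector) set_operator \<Rightarrow> bool" where
  "monotone_op A \<longleftrightarrow>
    (\<forall>(x, x') \<in> gra A. \<forall>(y, y') \<in> gra A. 0 \<le> blinfun_apply (x' - y') (x - y))"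

definition maximally_monotone :: "('a::real_normed_vector) set_operator \<Rightarrow> bool" where
  "maximally_monotone A \<longleftrightarrow> monotone_op A \<and> \<not> (\<exists>B. monotone_op B \<and> gra A \<subset> gra B)"

text \<open>The Fitzpatrick function is of interest only when the graph is nonempty. For an
  empty graph the supremum below is \<open>-\<infinity>\<close>; this does not occur for maximally monotone
  operators, since every singleton graph is monotone.\<close>

definition fitzpatrick ::
    "('a::real_normed_vector) set_operator \<Rightarrow> 'a \<times> 'a dual \<Rightarrow> ereal" where
  "fitzpatrick A = (\<lambda>(x, x'). SUP (a, a') \<in> gra A.
     ereal (blinfun_apply a' x + blinfun_apply x' a - blinfun_apply a' a))"

definition dom_fitzpatrick ::
    "('a::real_normed_vector) set_operator \<Rightarrow> ('a \<times> 'a dual) set" where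
  "dom_fitzpatrick A = {p. \<exists>r::real. fitzpatrick A p = ereal r}"

end

theory Submission
  imports Defs
begin

text \<open>The inclusion from left to right holds because \<open>dom A\<close> lies in \<open>P\<^sub>X[dom F\<^sub>A]\<close> (on the graph
  of a monotone operator the Fitzpatrick function is the duality pairing) and \<open>dom F\<^sub>A\<close>, the
  set where a family of affine functions is bounded above, is convex.

  For the converse suppose that \<open>F\<^sub>A(x, x')\<close> is finite, which means that
  \<open>\<langle>x - a, x' - a'\<rangle>\<close> is bounded below over the graph, and that \<open>x\<close> lies outside the closed
  convex hull of \<open>dom A\<close>. A functional \<open>y'\<close> separates strictly: \<open>\<langle>x - a, y'\<rangle> \<ge> d > 0\<close> for
  all \<open>a\<close> in \<open>dom A\<close>. Adding a large multiple \<open>t y'\<close> to \<open>x'\<close> raises each of these pairings by at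
  least \<open>t d\<close>, so that \<open>(x, x' + t y')\<close> becomes monotonically related to the whole graph. By
  maximality it belongs to the graph, which puts \<open>x\<close> into \<open>dom A\<close>: a contradiction.

  The separation of a point from a convex set in a normed space is derived from the
  Mazur--Orlicz form of the Hahn--Banach theorem (\<open>mazur_orlicz\<close>). A sublinear functional that
  is minimal for the pointwise order is linear, and Zorn's lemma provides minimal ones. A single
  construction, \<open>lower_sublinear\<close>, decreases a sublinear functional so that its values on
  \<open>- D\<close> become as small as required. With \<open>D\<close> a single point it shows that minimality forces
  linearity; with \<open>D\<close> the given convex set it turns a linear minorant into the desired one.\<close>

section \<open>Sublinear functionals and the Hahn--Banach theorem\<close>

definition sublinear :: "('a::real_vector \<Rightarrow> real) \<Rightarrow> bool" where
  "sublinear q \<longleftrightarrow>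
    (\<forall>x y. q (x + y) \<le> q x + q y) \<and> (\<forall>t x. 0 \<le> t \<longrightarrow> q (t *\<^sub>R x) = t * q x)"

lemma sublinear_add: "sublinear q \<Longrightarrow> q (x + y) \<le> q x + q y"
  and sublinear_scale: "sublinear q \<Longrightarrow> 0 \<le> t \<Longrightarrow> q (t *\<^sub>R x) = t * q x"
  by (auto simp: sublinear_def)

lemma sublinear_zero: "sublinear q \<Longrightarrow> q 0 = 0"
  using sublinear_scale[of q 0 0] by simp

lemma sublinear_minus_ge: "sublinear q \<Longrightarrow> - q (- x) \<le> q x"
  using sublinear_add[of q x "- x"] sublinear_zero[of q] by simp

lemma sublinear_norm: "sublinear (norm :: 'a::real_normed_vector \<Rightarrow> real)"
  by (auto simp: sublinear_def norm_triangle_ineq)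

text \<open>Infima of chains and the construction \<open>lower_sublinear\<close> below are both instances of this
  criterion. The index \<open>k\<close> may depend on the vectors, so that the members of the family need not
  be sublinear themselves; only the family has to be closed under sums and scalings.\<close>

lemma sublinear_INF:
  fixes q :: "'a::real_vector \<Rightarrow> real" and g :: "'i \<Rightarrow> 'a \<Rightarrow> real"
  assumes q: "sublinear q"
    and b: "b \<in> I" "\<And>v. g b v \<le> q v"
    and lower: "\<And>i v. i \<in> I \<Longrightarrow> - q (- v) \<le> g i v"
    and add: "\<And>i j v w. i \<in> I \<Longrightarrow> j \<in> I \<Longrightarrow> \<exists>k\<in>I. g k (v + w) \<le> g i v + g j w"
    and scale: "\<And>i t v. i \<in> I \<Longrightarrow> 0 < t \<Longrightarrow> \<exists>k\<in>I. g k (t *\<^sub>R v) \<le> t * g i v"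
  shows "sublinear (\<lambda>v. INF i\<in>I. g i v)"
    and "\<And>i v. i \<in> I \<Longrightarrow> (INF i\<in>I. g i v) \<le> g i v"
proof -
  define p where "p v = (INF i\<in>I. g i v)" for v
  have ne: "I \<noteq> {}"
    using b by auto
  have le: "p v \<le> g i v" if "i \<in> I" for i v
    unfolding p_def using that lower by (intro cINF_lower bdd_belowI2[where m = "- q (- v)"])
  then show "\<And>i v. i \<in> I \<Longrightarrow> (INF i\<in>I. g i v) \<le> g i v"
    by (simp add: p_def)
  have ge: "c \<le> p v" if "\<And>i. i \<in> I \<Longrightarrow> c \<le> g i v" for c v
    unfolding p_def using that ne by (intro cINF_greatest)
  have "p (v + w) \<le> p v + p w" for v w
  proof -
    have "p (v + w) - p w \<le> g i v" if i: "i \<in> I" for i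
    proof -
      have "p (v + w) - g i v \<le> g j w" if j: "j \<in> I" for j
      proof -
        obtain k where "k \<in> I" "g k (v + w) \<le> g i v + g j w"
          using add[OF i j] by blast
        then show ?thesis
          using le[of k "v + w"] by linarith
      qed
      then have "p (v + w) - g i v \<le> p w"
        by (rule ge)
      then show ?thesis
        by linarith
    qed
    then have "p (v + w) - p w \<le> p v"
      by (rule ge)
    then show ?thesis
      by linarith
  qed
  moreover have scale_le: "p (t *\<^sub>R v) \<le> t * p v" if t: "0 < t" for t v
  proof -
    have "p (t *\<^sub>R v) / t \<le> g i v" if i: "i \<in> I" for i
    proof -
      obtain k where "k \<in> I" "g k (t *\<^sub>R v) \<le> t * g i v"
        using scale[OF i t] by blast
      then have "p (t *\<^sub>R v) \<le> t * g i v"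
        using le[of k "t *\<^sub>R v"] by linarith
      then show ?thesis
        using t by (simp add: divide_le_eq mult.commute)
    qed
    then have "p (t *\<^sub>R v) / t \<le> p v"
      by (rule ge)
    then show ?thesis
      using t by (simp add: divide_le_eq mult.commute)
  qed
  moreover have "p (t *\<^sub>R v) = t * p v" if "0 \<le> t" for t v
  proof (cases "t = 0")
    case True
    have "p 0 \<le> 0"
      using le[OF b(1), of 0] b(2)[of 0] sublinear_zero[OF q] by linarith
    moreover have "0 \<le> p 0"
      using ge[of 0 0] lower[of _ 0] sublinear_zero[OF q] by simp
    ultimately show ?thesis
      using True by simp
  next
    case False
    then have t: "0 < t"
      using that by simp
    have "p v \<le> inverse t * p (t *\<^sub>R v)"
      using scale_le[of "inverse t" "t *\<^sub>R v"] t by simp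
    then have "t * p v \<le> p (t *\<^sub>R v)"
      using t by (simp add: field_simps)
    then show ?thesis
      using scale_le[OF t, of v] by linarith
  qed
  ultimately have "sublinear p"
    by (simp add: sublinear_def)
  then show "sublinear (\<lambda>v. INF i\<in>I. g i v)"
    by (simp add: p_def[abs_def])
qed

text \<open>The functional \<open>p v = inf {q (v + t c) - t d | t \<ge> 0, c \<in> D}\<close> works: \<open>t = 0\<close> gives
  \<open>p \<le> q\<close>, and \<open>t = 1\<close>, \<open>v = - c\<close> gives the bound on \<open>- D\<close>. It is finite because \<open>d \<le> q\<close> on
  \<open>D\<close>, and it is subadditive because \<open>D\<close> is convex.\<close>

lemma lower_sublinear:
  fixes q :: "'a::real_vector \<Rightarrow> real"
  assumes q: "sublinear q" and D: "convex D" "D \<noteq> {}" and d: "\<And>c. c \<in> D \<Longrightarrow> d \<le> q c"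
  obtains p where "sublinear p" "\<And>v. p v \<le> q v" "\<And>c. c \<in> D \<Longrightarrow> p (- c) \<le> - d"
proof -
  define g where "g = (\<lambda>(t, c) v. q (v + t *\<^sub>R c) - t * d)"
  define I where "I = {0::real..} \<times> D"
  obtain c0 where c0: "c0 \<in> D"
    using D by auto
  have start: "(0, c0) \<in> I" "g (0, c0) v \<le> q v" for v
    using c0 by (auto simp: I_def g_def)
  have lower: "- q (- v) \<le> g i v" if "i \<in> I" for i v
  proof -
    obtain t c where i: "i = (t, c)" "0 \<le> t" "c \<in> D"
      using \<open>i \<in> I\<close> by (auto simp: I_def)
    have "t * d \<le> t * q c"
      using i d by (intro mult_left_mono) auto
    also have "\<dots> = q ((v + t *\<^sub>R c) + - v)"
      using i q by (simp add: sublinear_scale)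
    also have "\<dots> \<le> q (v + t *\<^sub>R c) + q (- v)"
      by (rule sublinear_add[OF q])
    finally show ?thesis
      by (simp add: i g_def)
  qed
  have add: "\<exists>k\<in>I. g k (v + w) \<le> g i v + g j w" if "i \<in> I" "j \<in> I" for i j v w
  proof -
    obtain t c s e where ij: "i = (t, c)" "0 \<le> t" "c \<in> D" "j = (s, e)" "0 \<le> s" "e \<in> D"
      using \<open>i \<in> I\<close> \<open>j \<in> I\<close> by (auto simp: I_def)
    obtain b where b: "b \<in> D" "(t + s) *\<^sub>R b = t *\<^sub>R c + s *\<^sub>R e"
    proof (cases "t + s = 0")
      case True
      then have "t = 0" "s = 0"
        using ij by auto
      then show ?thesis
        using that[of c] ij by simp
    next
      case False
      then have pos: "0 < t + s"
        using ij by simp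
      have "(t / (t + s)) *\<^sub>R c + (s / (t + s)) *\<^sub>R e \<in> D"
        using pos ij by (intro convexD[OF D(1)]) (auto simp: add_divide_distrib[symmetric])
      then show ?thesis
        using pos by (intro that[of "(t / (t + s)) *\<^sub>R c + (s / (t + s)) *\<^sub>R e"])
          (auto simp: scaleR_add_right)
    qed
    have "q ((v + w) + (t + s) *\<^sub>R b) = q ((v + t *\<^sub>R c) + (w + s *\<^sub>R e))"
      by (simp only: b(2)) (simp add: add_ac)
    also have "\<dots> \<le> q (v + t *\<^sub>R c) + q (w + s *\<^sub>R e)"
      by (rule sublinear_add[OF q])
    finally have "g (t + s, b) (v + w) \<le> g i v + g j w"
      by (simp add: ij g_def algebra_simps)
    moreover have "(t + s, b) \<in> I"
      using ij b by (simp add: I_def)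
    ultimately show ?thesis
      by blast
  qed
  have scale: "\<exists>k\<in>I. g k (r *\<^sub>R v) \<le> r * g i v" if "i \<in> I" "0 < r" for i r v
  proof -
    obtain t c where i: "i = (t, c)" "0 \<le> t" "c \<in> D"
      using \<open>i \<in> I\<close> by (auto simp: I_def)
    have "q (r *\<^sub>R v + (r * t) *\<^sub>R c) = r * q (v + t *\<^sub>R c)"
      using sublinear_scale[OF q, of r "v + t *\<^sub>R c"] \<open>0 < r\<close> by (simp add: scaleR_add_right)
    then have "g (r * t, c) (r *\<^sub>R v) \<le> r * g i v"
      by (simp add: i g_def algebra_simps)
    moreover have "(r * t, c) \<in> I"
      using i \<open>0 < r\<close> by (simp add: I_def)
    ultimately show ?thesis
      by blast
  qed
  have inf: "sublinear (\<lambda>v. INF i\<in>I. g i v)"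
    by (rule sublinear_INF[where q = q and g = g and I = I and b = "(0, c0)"])
      (fact q start lower add scale)+
  have inf_le: "(INF i\<in>I. g i v) \<le> g i v" if "i \<in> I" for i v
    by (rule sublinear_INF(2)[where q = q and g = g and I = I and b = "(0, c0)"])
      (fact q start lower add scale that)+
  show ?thesis
  proof (rule that)
    show "sublinear (\<lambda>v. INF i\<in>I. g i v)"
      by (fact inf)
    show "(INF i\<in>I. g i v) \<le> q v" for v
      using inf_le[OF start(1), of v] start(2)[of v] by linarith
    show "(INF i\<in>I. g i (- c)) \<le> - d" if "c \<in> D" for c
      using inf_le[of "(1, c)" "- c"] that sublinear_zero[OF q] by (simp add: I_def g_def)
  qed
qed

text \<open>Lowering a minimal \<open>q\<close> along the single point \<open>y\<close> to \<open>- q y\<close> at \<open>- y\<close> changes nothing, so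
  \<open>q\<close> is odd; an odd sublinear functional is linear.\<close>

lemma minimal_sublinear_linear:
  fixes q :: "'a::real_vector \<Rightarrow> real"
  assumes q: "sublinear q" and min: "\<And>p. sublinear p \<Longrightarrow> (\<And>v. p v \<le> q v) \<Longrightarrow> p = q"
  shows "linear q"
proof -
  have odd: "q (- y) = - q y" for y
  proof -
    obtain p where p: "sublinear p" "\<And>v. p v \<le> q v" "\<And>c. c \<in> {y} \<Longrightarrow> p (- c) \<le> - q y"
      by (rule lower_sublinear[of q "{y}" "q y"]) (use q in auto)
    have "p = q"
      using p by (intro min)
    then have "q (- y) \<le> - q y"
      using p(3)[of y] by simp
    then show ?thesis
      using sublinear_minus_ge[OF q, of y] by linarith
  qed
  show ?thesis
  proof (rule linearI)
    show "q (x + y) = q x + q y" for x y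
      using sublinear_add[OF q, of x y] sublinear_add[OF q, of "- x" "- y"]
        odd[of x] odd[of y] odd[of "x + y"] by simp
    show "q (t *\<^sub>R x) = t *\<^sub>R q x" for t x
    proof (cases "0 \<le> t")
      case True
      then show ?thesis
        using sublinear_scale[OF q] by simp
    next
      case False
      then have "q ((- t) *\<^sub>R x) = - t * q x"
        by (intro sublinear_scale[OF q]) simp
      then show ?thesis
        using odd[of "t *\<^sub>R x"] by simp
    qed
  qed
qed

text \<open>Zorn's lemma applies because the pointwise infimum of a chain of sublinear minorants of \<open>q\<close>
  is finite, each member being bounded below by \<open>- q (- v)\<close> at \<open>v\<close>.\<close>

lemma linear_minorant:
  fixes q :: "'a::real_vector \<Rightarrow> real"
  assumes q: "sublinear q"
  obtains f where "linear f" "\<And>v. f v \<le> q v"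
proof -
  define S where "S = {p. sublinear p \<and> (\<forall>v. p v \<le> q v)}"
  define R where "R = (\<lambda>p p' :: 'a \<Rightarrow> real. p' \<le> p)"
  have qS: "q \<in> S"
    using q by (simp add: S_def)
  have "partial_order_on S (relation_of R S)"
    by (rule partial_order_on_relation_ofI) (auto simp: R_def)
  moreover have "\<exists>u\<in>S. \<forall>p\<in>C. R p u" if C: "C \<in> Chains (relation_of R S)" for C
  proof (cases "C = {}")
    case True
    then show ?thesis
      using qS by auto
  next
    case False
    then obtain p0 where p0: "p0 \<in> C"
      by auto
    have CS: "sublinear p" "p v \<le> q v" if "p \<in> C" for p v
      using C that by (auto simp: Chains_def relation_of_def S_def)
    have chain: "p \<le> p' \<or> p' \<le> p" if "p \<in> C" "p' \<in> C" for p p'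
      using C that by (auto simp: Chains_def relation_of_def R_def)
    have lower: "- q (- v) \<le> p v" if "p \<in> C" for p v
      using sublinear_minus_ge[OF CS(1)[OF that], of v] CS(2)[OF that, of "- v"] by linarith
    have add: "\<exists>k\<in>C. k (v + w) \<le> i v + j w" if ij: "i \<in> C" "j \<in> C" for i j v w
    proof -
      \<comment> \<open>The smaller of the two members of the chain serves as index.\<close>
      obtain k where k: "k \<in> C" "k \<le> i" "k \<le> j"
        using chain[OF ij] ij by blast
      have "k (v + w) \<le> k v + k w"
        by (rule sublinear_add[OF CS(1)[OF k(1)]])
      also have "\<dots> \<le> i v + j w"
        using k by (intro add_mono) (auto simp: le_fun_def)
      finally show ?thesis
        using k(1) by blast
    qed
    have scale: "\<exists>k\<in>C. k (t *\<^sub>R v) \<le> t * i v" if "i \<in> C" "0 < t" for i t v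
      using sublinear_scale[OF CS(1)[OF \<open>i \<in> C\<close>], of t v] that by (intro bexI[of _ i]) auto
    have inf: "sublinear (\<lambda>v. INF p\<in>C. p v)"
      by (rule sublinear_INF[where q = q and g = "\<lambda>p. p" and I = C and b = p0])
        (fact q p0 CS(2)[OF p0] lower add scale)+
    have inf_le: "(INF p\<in>C. p v) \<le> p v" if "p \<in> C" for p v
      by (rule sublinear_INF(2)[where q = q and g = "\<lambda>p. p" and I = C and b = p0])
        (fact q p0 CS(2)[OF p0] lower add scale that)+
    have "(INF p\<in>C. p v) \<le> q v" for v
      using inf_le[OF p0, of v] CS(2)[OF p0, of v] by linarith
    then have "(\<lambda>v. INF p\<in>C. p v) \<in> S"
      using inf by (simp add: S_def)
    moreover have "\<forall>p\<in>C. R p (\<lambda>v. INF p\<in>C. p v)"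
      using inf_le by (auto simp: R_def le_fun_def)
    ultimately show ?thesis
      by blast
  qed
  ultimately have "\<exists>m\<in>S. \<forall>p\<in>S. R m p \<longrightarrow> p = m"
    by (rule predicate_Zorn)
  then obtain m where m: "m \<in> S" "\<And>p. p \<in> S \<Longrightarrow> p \<le> m \<Longrightarrow> p = m"
    by (auto simp: R_def)
  have mS: "sublinear m" "\<And>v. m v \<le> q v"
    using m(1) by (auto simp: S_def)
  have "linear m"
  proof (rule minimal_sublinear_linear[OF mS(1)])
    fix p :: "'a \<Rightarrow> real"
    assume p: "sublinear p" "\<And>v. p v \<le> m v"
    then have "p v \<le> q v" for v
      using order_trans[OF p(2) mS(2)] by blast
    then show "p = m"
      using p by (intro m(2)) (auto simp: S_def le_fun_def)
  qed
  then show ?thesis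
    using mS(2) by (rule that)
qed

lemma mazur_orlicz:
  fixes q :: "'a::real_vector \<Rightarrow> real"
  assumes "sublinear q" "convex D" "D \<noteq> {}" "\<And>c. c \<in> D \<Longrightarrow> d \<le> q c"
  obtains f where "linear f" "\<And>v. f v \<le> q v" "\<And>c. c \<in> D \<Longrightarrow> d \<le> f c"
proof -
  obtain p where p: "sublinear p" "\<And>v. p v \<le> q v" "\<And>c. c \<in> D \<Longrightarrow> p (- c) \<le> - d"
    using lower_sublinear[OF assms] by blast
  obtain f where f: "linear f" "\<And>v. f v \<le> p v"
    using linear_minorant[OF p(1)] by blast
  show ?thesis
  proof (rule that[OF f(1)])
    show "f v \<le> q v" for v
      using f(2)[of v] p(2)[of v] by linarith
    show "d \<le> f c" if "c \<in> D" for c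
      using f(2)[of "- c"] p(3)[OF that] linear_neg[OF f(1), of c] by linarith
  qed
qed

text \<open>The Mazur--Orlicz theorem is applied to the norm and the convex set \<open>x - C\<close>, on which the
  norm is bounded away from \<open>0\<close> since \<open>x\<close> is not in the closure of \<open>C\<close>; a linear functional
  below the norm is bounded.\<close>

lemma separate_point_convex:
  fixes x :: "'a::real_normed_vector"
  assumes C: "convex C" and x: "x \<notin> closure C"
  obtains f :: "'a \<Rightarrow>\<^sub>L real" and d :: real
  where "0 < d" "\<And>a. a \<in> C \<Longrightarrow> d \<le> blinfun_apply f (x - a)"
proof (cases "C = {}")
  case True
  then show ?thesis
    using that[of 1] by auto
next
  case False
  obtain d where d: "0 < d" "\<And>a. a \<in> C \<Longrightarrow> d \<le> dist a x"
    using x unfolding closure_approachable by (meson not_less)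
  define D where "D = (\<lambda>a. x - a) ` C"
  have "convex D"
    using convex_translation[OF convex_negations[OF C], of x] by (simp add: D_def image_image)
  moreover have "D \<noteq> {}"
    using False by (simp add: D_def)
  moreover have "d \<le> norm c" if "c \<in> D" for c
    using that d(2) by (auto simp: D_def dist_norm norm_minus_commute)
  ultimately obtain f where f: "linear f" "\<And>v. f v \<le> norm v" "\<And>c. c \<in> D \<Longrightarrow> d \<le> f c"
    using mazur_orlicz[OF sublinear_norm] by blast
  have "norm (f v) \<le> norm v * 1" for v
    using f(2)[of v] f(2)[of "- v"] linear_neg[OF f(1), of v] by (simp add: abs_le_iff)
  then have "bounded_linear f"
    using f(1) by (intro bounded_linear.intro bounded_linear_axioms.intro) blast+
  then have "blinfun_apply (Blinfun f) = f"
    by (rule bounded_linear_Blinfun_apply)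
  then show ?thesis
    using that[of d "Blinfun f"] d(1) f(3) by (simp add: D_def)
qed

section \<open>Maximal monotonicity and the domain of the Fitzpatrick function\<close>

lemma maximally_monotone_mem:
  assumes A: "maximally_monotone A"
    and rel: "\<And>a a'. (a, a') \<in> gra A \<Longrightarrow> 0 \<le> blinfun_apply (x' - a') (x - a)"
  shows "(x, x') \<in> gra A"
proof (rule ccontr)
  assume notin: "(x, x') \<notin> gra A"
  define B where "B = A(x := insert x' (A x))"
  have gB: "gra B = insert (x, x') (gra A)"
    by (auto simp: gra_def B_def split: if_splits)
  have flip: "blinfun_apply (a' - x') (a - x) = blinfun_apply (x' - a') (x - a)" for a a'
    by (simp add: blinfun.diff_left blinfun.diff_right)
  have "monotone_op B"
    using A rel unfolding maximally_monotone_def monotone_op_def gB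
    by (auto simp: flip)
  moreover have "gra A \<subset> gra B"
    using notin gB by auto
  ultimately show False
    using A by (auto simp: maximally_monotone_def)
qed

lemma maximally_monotone_gra_nonempty:
  assumes "maximally_monotone A"
  shows "gra A \<noteq> {}"
  using maximally_monotone_mem[OF assms, of 0 0] by auto

text \<open>Since the graph is nonempty, the supremum can only fail to be real by being \<open>\<infinity>\<close>.\<close>

lemma dom_fitzpatrick_iff:
  assumes ne: "gra A \<noteq> {}"
  shows "(x, x') \<in> dom_fitzpatrick A \<longleftrightarrow>
    (\<exists>r. \<forall>(a, a') \<in> gra A.
      blinfun_apply a' x + blinfun_apply x' a - blinfun_apply a' a \<le> r)"
    (is "_ \<longleftrightarrow> (\<exists>r. \<forall>(a, a') \<in> gra A. ?h a a' \<le> r)")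
proof
  assume "(x, x') \<in> dom_fitzpatrick A"
  then obtain r where r: "fitzpatrick A (x, x') = ereal r"
    by (auto simp: dom_fitzpatrick_def)
  have "?h a a' \<le> r" if "(a, a') \<in> gra A" for a a'
  proof -
    have "ereal (?h a a') \<le> fitzpatrick A (x, x')"
      unfolding fitzpatrick_def using that by (auto intro!: SUP_upper2)
    then show ?thesis
      by (simp add: r)
  qed
  then show "\<exists>r. \<forall>(a, a') \<in> gra A. ?h a a' \<le> r"
    by blast
next
  assume "\<exists>r. \<forall>(a, a') \<in> gra A. ?h a a' \<le> r"
  then obtain r where r: "\<And>a a'. (a, a') \<in> gra A \<Longrightarrow> ?h a a' \<le> r"
    by blast
  obtain b b' where b: "(b, b') \<in> gra A"
    using ne by auto
  have "fitzpatrick A (x, x') \<le> ereal r"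
    unfolding fitzpatrick_def using r by (auto intro!: SUP_least)
  moreover have "ereal (?h b b') \<le> fitzpatrick A (x, x')"
    unfolding fitzpatrick_def using b by (auto intro!: SUP_upper2)
  ultimately show "(x, x') \<in> dom_fitzpatrick A"
    by (cases "fitzpatrick A (x, x')") (auto simp: dom_fitzpatrick_def)
qed

lemma convex_fst_dom_fitzpatrick:
  assumes ne: "gra A \<noteq> {}"
  shows "convex (fst ` dom_fitzpatrick A)"
proof (rule convexI)
  fix x y and u v :: real
  assume x: "x \<in> fst ` dom_fitzpatrick A" and y: "y \<in> fst ` dom_fitzpatrick A"
    and uv: "0 \<le> u" "0 \<le> v" "u + v = 1"
  obtain x' y' where "(x, x') \<in> dom_fitzpatrick A" "(y, y') \<in> dom_fitzpatrick A"
    using x y by auto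
  then obtain r s
    where r: "\<And>a a'. (a, a') \<in> gra A \<Longrightarrow>
        blinfun_apply a' x + blinfun_apply x' a - blinfun_apply a' a \<le> r"
      and s: "\<And>a a'. (a, a') \<in> gra A \<Longrightarrow>
        blinfun_apply a' y + blinfun_apply y' a - blinfun_apply a' a \<le> s"
    unfolding dom_fitzpatrick_iff[OF ne] by blast
  let ?z = "u *\<^sub>R x + v *\<^sub>R y" and ?z' = "u *\<^sub>R x' + v *\<^sub>R y'"
  have "blinfun_apply a' ?z + blinfun_apply ?z' a - blinfun_apply a' a \<le> u * r + v * s"
    if a: "(a, a') \<in> gra A" for a a'
  proof -
    have v: "v = 1 - u"
      using uv by simp
    have "blinfun_apply a' ?z + blinfun_apply ?z' a - blinfun_apply a' a
      = u * (blinfun_apply a' x + blinfun_apply x' a - blinfun_apply a' a)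
        + v * (blinfun_apply a' y + blinfun_apply y' a - blinfun_apply a' a)"
      unfolding v by (simp add: blinfun.bilinear_simps algebra_simps)
    also have "\<dots> \<le> u * r + v * s"
      using r[OF a] s[OF a] uv by (intro add_mono mult_left_mono)
    finally show ?thesis .
  qed
  then have "(?z, ?z') \<in> dom_fitzpatrick A"
    unfolding dom_fitzpatrick_iff[OF ne] by blast
  then show "?z \<in> fst ` dom_fitzpatrick A"
    by force
qed

text \<open>At a point of the graph, monotonicity bounds every term of the supremum by
  \<open>\<langle>x, x'\<rangle>\<close>.\<close>

lemma gra_subset_dom_fitzpatrick:
  assumes A: "monotone_op A"
  shows "gra A \<subseteq> dom_fitzpatrick A"
proof (rule subrelI)
  fix x x'
  assume x: "(x, x') \<in> gra A"
  then have ne: "gra A \<noteq> {}"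
    by auto
  have "blinfun_apply a' x + blinfun_apply x' a - blinfun_apply a' a \<le> blinfun_apply x' x"
    if "(a, a') \<in> gra A" for a a'
  proof -
    have "0 \<le> blinfun_apply (x' - a') (x - a)"
      using A x that unfolding monotone_op_def by blast
    then show ?thesis
      by (simp add: blinfun.bilinear_simps)
  qed
  then show "(x, x') \<in> dom_fitzpatrick A"
    unfolding dom_fitzpatrick_iff[OF ne] by blast
qed

lemma fst_dom_fitzpatrick_subset:
  fixes A :: "('a::real_normed_vector) set_operator"
  assumes A: "maximally_monotone A"
  shows "fst ` dom_fitzpatrick A \<subseteq> closure (convex hull (dom_op A))"
proof
  fix x
  assume "x \<in> fst ` dom_fitzpatrick A"
  then obtain x' where "(x, x') \<in> dom_fitzpatrick A"
    by auto
  then obtain r where r: "\<And>a a'. (a, a') \<in> gra A \<Longrightarrow>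
      blinfun_apply a' x + blinfun_apply x' a - blinfun_apply a' a \<le> r"
    unfolding dom_fitzpatrick_iff[OF maximally_monotone_gra_nonempty[OF A]] by blast
  show "x \<in> closure (convex hull (dom_op A))"
  proof (rule ccontr)
    assume outside: "x \<notin> closure (convex hull (dom_op A))"
    obtain y' :: "'a dual" and d :: real where d: "0 < d"
      and y': "\<And>a. a \<in> convex hull (dom_op A) \<Longrightarrow> d \<le> blinfun_apply y' (x - a)"
      using separate_point_convex[OF convex_convex_hull outside] by blast
    \<comment> \<open>The pairing \<open>\<langle>x - a, x' - a'\<rangle>\<close> is at least \<open>\<langle>x, x'\<rangle> - r\<close>; the multiple \<open>t\<close>
      makes up for a negative value of this bound.\<close>
    define t where "t = \<bar>r - blinfun_apply x' x\<bar> / d"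
    have "0 \<le> blinfun_apply ((x' + t *\<^sub>R y') - a') (x - a)" if a: "(a, a') \<in> gra A" for a a'
    proof -
      have "a \<in> convex hull (dom_op A)"
        using a by (intro hull_inc) (auto simp: gra_def dom_op_def)
      then have "t * d \<le> t * blinfun_apply y' (x - a)"
        using d by (intro mult_left_mono y') (auto simp: t_def)
      moreover have "t * d = \<bar>r - blinfun_apply x' x\<bar>"
        using d by (simp add: t_def)
      moreover have "blinfun_apply ((x' + t *\<^sub>R y') - a') (x - a)
        = blinfun_apply x' x - (blinfun_apply a' x + blinfun_apply x' a - blinfun_apply a' a)
          + t * blinfun_apply y' (x - a)"
        by (simp add: blinfun.bilinear_simps algebra_simps)
      ultimately show ?thesis
        using r[OF a] by linarith
    qed
    then have "(x, x' + t *\<^sub>R y') \<in> gra A"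
      by (rule maximally_monotone_mem[OF A])
    then have "x \<in> dom_op A"
      by (auto simp: gra_def dom_op_def)
    then have "x \<in> closure (convex hull (dom_op A))"
      by (intro subsetD[OF closure_subset] hull_inc)
    then show False
      using outside by simp
  qed
qed

theorem theorem3p6:
  fixes A :: "'a::banach \<Rightarrow> ('a \<Rightarrow>\<^sub>L real) set"
  assumes "maximally_monotone A"
  shows "closure (convex hull (dom_op A)) = closure (fst ` dom_fitzpatrick A)"
proof
  have "dom_op A \<subseteq> fst ` gra A"
    by (force simp: dom_op_def gra_def)
  also have "\<dots> \<subseteq> fst ` dom_fitzpatrick A"
    using assms by (intro image_mono gra_subset_dom_fitzpatrick) (simp add: maximally_monotone_def)
  finally have "convex hull (dom_op A) \<subseteq> fst ` dom_fitzpatrick A"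
    by (intro hull_minimal convex_fst_dom_fitzpatrick maximally_monotone_gra_nonempty assms)
  then show "closure (convex hull (dom_op A)) \<subseteq> closure (fst ` dom_fitzpatrick A)"
    by (rule closure_mono)
next
  show "closure (fst ` dom_fitzpatrick A) \<subseteq> closure (convex hull (dom_op A))"
    using fst_dom_fitzpatrick_subset[OF assms] by (simp add: closure_minimal)
qed

end
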